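(* Let $\epsilon>0$ be a constant. Any deterministic clock auction that is augmented with a prediction $\hat{\texttt{OPT}}$ and is $(1+\epsilon)$-consistent has robustness $\Omega\!\left(\frac{1}{\epsilon}\log n\right)$, where $n$ is the number of bidders.
   Context: Setting: a set $N$ of $n$ bidders with private values $v_i\ge v_{\min}>0$; a public downward-closed family $\mathcal F\subseteq 2^N$ of feasible sets; $v(S)=\sum_{i\in S}v_i$; $\texttt{OPT}(I)$ is a maximum-value feasible set of instance $I$. A clock auction offers each active bidder personalized prices that are non-decreasing over time and depend only on public information (feasibility system, prediction, price history, exit history); a bidder stays while the price is at most her value and otherwise permanently exits; the auction ends when the active set is feasible and serves it. A learning-augmented auction $\mathcal M$ additionally receives a prediction $\hat{\texttt{OPT}}\in\mathcal F$ (possibly wrong). Robustness: $\max_{I,\hat{\texttt{OPT}}}v(\texttt{OPT}(I))/v(\mathcal M(I,\hat{\texttt{OPT}}))$. Consistency: $\max_I v(\texttt{OPT}(I))/v(\mathcal M(I,\texttt{OPT}(I)))$. $c$-consistent means consistency at most $c$. *)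

theory Defs
  imports "HOL-Library.Extended_Real"
begin

definition feasibility_system :: "nat \<Rightarrow> nat set set \<Rightarrow> bool" where
  "feasibility_system n F \<longleftrightarrow>
     F \<subseteq> Pow {..<n} \<and> {} \<in> F \<and> (\<forall>S\<in>F. \<forall>T. T \<subseteq> S \<longrightarrow> T \<in> F)"

definition setval :: "(nat \<Rightarrow> real) \<Rightarrow> nat set \<Rightarrow> real" where
  "setval v S = (\<Sum>i\<in>S. v i)"

definition opt_val :: "nat set set \<Rightarrow> (nat \<Rightarrow> real) \<Rightarrow> real" where
  "opt_val F v = Max (setval v ` F)"

definition is_opt :: "nat set set \<Rightarrow> (nat \<Rightarrow> real) \<Rightarrow> nat set \<Rightarrow> bool" where
  "is_opt F v S \<longleftrightarrow> S \<in> F \<and> setval v S = opt_val F v"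

text \<open>A deterministic (learning-augmented) clock auction, modelled in discrete rounds.
The price vector offered in a round is a function of the public information only:
the feasibility system, the prediction, and the history of active sets (the exit
history; the price history is itself determined by these data since the auction
is deterministic).\<close>

type_synonym auction = "nat set set \<Rightarrow> nat set \<Rightarrow> nat set list \<Rightarrow> nat \<Rightarrow> real"

fun hist :: "auction \<Rightarrow> nat \<Rightarrow> nat set set \<Rightarrow> nat set \<Rightarrow> (nat \<Rightarrow> real) \<Rightarrow> nat \<Rightarrow> nat set list" where
  "hist M n F P v 0 = [{..<n}]"
| "hist M n F P v (Suc t) =
     (let h = hist M n F P v t; A = last h; p = M F P h in h @ [{i\<in>A. p i \<le> v i}])"

definition active :: "auction \<Rightarrow> nat \<Rightarrow> nat set set \<Rightarrow> nat set \<Rightarrow> (nat \<Rightarrow> real) \<Rightarrow> nat \<Rightarrow> nat set" where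
  "active M n F P v t = last (hist M n F P v t)"

definition price :: "auction \<Rightarrow> nat \<Rightarrow> nat set set \<Rightarrow> nat set \<Rightarrow> (nat \<Rightarrow> real) \<Rightarrow> nat \<Rightarrow> nat \<Rightarrow> real" where
  "price M n F P v t = M F P (hist M n F P v t)"

definition outcome :: "auction \<Rightarrow> nat \<Rightarrow> nat set set \<Rightarrow> nat set \<Rightarrow> (nat \<Rightarrow> real) \<Rightarrow> nat set" where
  "outcome M n F P v =
     (if \<exists>t. active M n F P v t \<in> F
      then active M n F P v (LEAST t. active M n F P v t \<in> F) else {})"

definition valid_instance :: "nat \<Rightarrow> real \<Rightarrow> nat set set \<Rightarrow> (nat \<Rightarrow> real) \<Rightarrow> bool" where
  "valid_instance n vmin F v \<longleftrightarrow> feasibility_system n F \<and> (\<forall>i<n. vmin \<le> v i)"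

definition clock_auction :: "nat \<Rightarrow> real \<Rightarrow> auction \<Rightarrow> bool" where
  "clock_auction n vmin M \<longleftrightarrow>
     (\<forall>F P v t. valid_instance n vmin F v \<and> P \<in> F \<longrightarrow>
        active M n F P v (Suc t) \<notin> F \<longrightarrow>
        (\<forall>i\<in>active M n F P v (Suc t). price M n F P v t i \<le> price M n F P v (Suc t) i))"

definition ratio :: "real \<Rightarrow> real \<Rightarrow> ereal" where
  "ratio a b = (if b = 0 then (if a = 0 then 1 else \<infinity>) else ereal (a / b))"

definition inst_ratio :: "auction \<Rightarrow> nat \<Rightarrow> nat set set \<Rightarrow> nat set \<Rightarrow> (nat \<Rightarrow> real) \<Rightarrow> ereal" where
  "inst_ratio M n F P v = ratio (opt_val F v) (setval v (outcome M n F P v))"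

definition robustness :: "nat \<Rightarrow> real \<Rightarrow> auction \<Rightarrow> ereal" where
  "robustness n vmin M =
     (SUP (F, P, v) \<in> {(F, P, v). valid_instance n vmin F v \<and> P \<in> F}. inst_ratio M n F P v)"

definition consistency :: "nat \<Rightarrow> real \<Rightarrow> auction \<Rightarrow> ereal" where
  "consistency n vmin M =
     (SUP (F, P, v) \<in> {(F, P, v). valid_instance n vmin F v \<and> is_opt F v P}. inst_ratio M n F P v)"

end

theory Submission
  imports Defs "HOL-Analysis.Harmonic_Numbers"
begin

text \<open>
  A coalition \<open>A\<close> of \<open>m\<close> bidders, which is also the prediction, competes with a single rival worth
  \<open>L\<close> times the budget \<open>D = m \<cdot> vmin\<close>: the feasible sets are \<open>{r}\<close> and the subsets of \<open>A\<close>. An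
  adversary fixes the values in \<open>A\<close> adaptively: while \<open>k\<close> of these bidders are left, each of them
  accepts prices up to \<open>D / k\<close>, so the survivors are worth \<open>D\<close> in total, and the first one asked
  for more leaves with value \<open>D / k\<close>. If the auction ever serves survivors only, then the rival
  forces its robustness up to \<open>L\<close>. Otherwise a single survivor is reached, and the bidders that left
  are worth \<open>D (H\<^sub>m - 1)\<close>. Let the survivor be worth as much as the rival: whatever is served now is
  worth at most \<open>L D\<close>, while the prediction \<open>A\<close> is optimal and worth \<open>L D + D (H\<^sub>m - 1)\<close>, so the
  consistency is at least \<open>1 + (H\<^sub>m - 1) / L\<close>. The choice \<open>L = ln n / (2 \<epsilon>)\<close> rules this out.
\<close>

section \<open>Value profiles and optimal values\<close>

definition raised_on :: "'a set \<Rightarrow> ('a \<Rightarrow> 'b :: preorder) \<Rightarrow> ('a \<Rightarrow> 'b) \<Rightarrow> bool" where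
  "raised_on X v w \<longleftrightarrow> (\<forall>i. if i \<in> X then v i \<le> w i else w i = v i)"

lemma raised_on_refl: "raised_on X v v"
  by (simp add: raised_on_def)

lemma raised_on_mono: "raised_on X v w \<Longrightarrow> X \<subseteq> Y \<Longrightarrow> raised_on Y v w"
  unfolding raised_on_def by (metis order_refl subset_eq)

lemma raised_on_trans: "raised_on X u v \<Longrightarrow> raised_on X v w \<Longrightarrow> raised_on X u w"
  unfolding raised_on_def by (metis order_trans)

lemma raised_on_le: "raised_on X v w \<Longrightarrow> v i \<le> w i"
  unfolding raised_on_def by (metis order_refl)

lemma raised_on_eq: "raised_on X v w \<Longrightarrow> i \<notin> X \<Longrightarrow> w i = v i"
  by (simp add: raised_on_def)

lemma setval_nonneg: "(\<And>i. i \<in> S \<Longrightarrow> 0 \<le> v i) \<Longrightarrow> 0 \<le> setval v S"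
  unfolding setval_def by (rule sum_nonneg)

lemma setval_mono:
  "finite T \<Longrightarrow> S \<subseteq> T \<Longrightarrow> (\<And>i. i \<in> T \<Longrightarrow> 0 \<le> v i) \<Longrightarrow> setval v S \<le> setval v T"
  unfolding setval_def by (rule sum_mono2) auto

lemma setval_raised_on: "raised_on X v w \<Longrightarrow> S \<inter> X = {} \<Longrightarrow> setval w S = setval v S"
  unfolding setval_def by (intro sum.cong) (auto intro: raised_on_eq)

lemma setval_le_opt_val: "finite F \<Longrightarrow> S \<in> F \<Longrightarrow> setval v S \<le> opt_val F v"
  by (simp add: opt_val_def)

lemma is_optI:
  assumes "finite F" "S \<in> F" "\<And>T. T \<in> F \<Longrightarrow> setval v T \<le> setval v S"
  shows "is_opt F v S"
  using assms by (auto simp: is_opt_def opt_val_def intro!: Max_eqI[symmetric])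

lemma inst_ratio_ge:
  assumes "0 < c" "0 < D" "c * D \<le> opt_val F v"
    and "0 \<le> setval v (outcome M n F P v)" "setval v (outcome M n F P v) \<le> D"
  shows "ereal c \<le> inst_ratio M n F P v"
proof (cases "setval v (outcome M n F P v) = 0")
  case True
  have "0 < c * D"
    using assms by simp
  then have "opt_val F v \<noteq> 0"
    using assms(3) by linarith
  with True show ?thesis
    by (simp add: inst_ratio_def ratio_def)
next
  case False
  have "c * setval v (outcome M n F P v) \<le> c * D"
    using assms by simp
  also note assms(3)
  finally show ?thesis
    using False assms(4) by (simp add: inst_ratio_def ratio_def le_divide_eq)
qed

lemma inst_ratio_le_robustness:
  "valid_instance n vmin F v \<Longrightarrow> P \<in> F \<Longrightarrow> inst_ratio M n F P v \<le> robustness n vmin M"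
  unfolding robustness_def by (rule SUP_upper2[of "(F, P, v)"]) auto

lemma inst_ratio_le_consistency:
  "valid_instance n vmin F v \<Longrightarrow> is_opt F v P \<Longrightarrow> inst_ratio M n F P v \<le> consistency n vmin M"
  unfolding consistency_def by (rule SUP_upper2[of "(F, P, v)"]) auto

section \<open>Runs of an auction\<close>

lemma active_0: "active M n F P v 0 = {..<n}"
  by (simp add: active_def)

lemma active_Suc:
  "active M n F P v (Suc t) = {i \<in> active M n F P v t. price M n F P v t i \<le> v i}"
  by (simp add: active_def price_def Let_def)

lemma active_antimono: "s \<le> t \<Longrightarrow> active M n F P v t \<subseteq> active M n F P v s"
  by (induction t rule: dec_induct) (auto simp: active_Suc)

lemma hist_raised_on:
  assumes "raised_on X v w" "X \<subseteq> active M n F P v t"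
  shows "hist M n F P w t = hist M n F P v t"
  using assms(2)
proof (induction t)
  case (Suc t)
  have "hist M n F P w t = hist M n F P v t"
    using Suc.prems by (intro Suc.IH) (auto simp: active_Suc)
  moreover have "price M n F P v t i \<le> w i \<longleftrightarrow> price M n F P v t i \<le> v i" for i
  proof (cases "i \<in> X")
    case True
    then have "price M n F P v t i \<le> v i"
      using Suc.prems by (auto simp: active_Suc)
    then show ?thesis
      using raised_on_le[OF assms(1), of i] by linarith
  qed (simp add: raised_on_eq[OF assms(1)])
  ultimately show ?case
    by (simp add: Let_def price_def)
qed simp

lemma outcome_in_feasible: "{} \<in> F \<Longrightarrow> outcome M n F P v \<in> F"
  by (auto simp: outcome_def intro: LeastI_ex)

lemma outcome_nonemptyE:
  assumes "outcome M n F P v \<noteq> {}"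
  obtains t where "outcome M n F P v = active M n F P v t"
    and "\<And>s. s < t \<Longrightarrow> active M n F P v s \<notin> F"
proof (rule that)
  let ?t = "LEAST t. active M n F P v t \<in> F"
  show "outcome M n F P v = active M n F P v ?t"
    using assms unfolding outcome_def by metis
  show "active M n F P v s \<notin> F" if "s < ?t" for s
    using that by (rule not_less_Least)
qed

lemma outcome_subset_active:
  assumes "\<And>s. s < t \<Longrightarrow> active M n F P v s \<notin> F"
  shows "outcome M n F P v \<subseteq> active M n F P v t"
proof (cases "\<exists>t. active M n F P v t \<in> F")
  case True
  then have "active M n F P v (LEAST t. active M n F P v t \<in> F) \<in> F"
    by (rule LeastI_ex)
  then have "t \<le> (LEAST t. active M n F P v t \<in> F)"
    using assms not_less by blast
  then show ?thesis
    using True by (simp add: outcome_def active_antimono)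
qed (simp add: outcome_def)

lemma first_exitE:
  assumes "X \<subseteq> {..<n}" "\<not> X \<subseteq> active M n F P v r"
  obtains s x where "s < r" "X \<subseteq> active M n F P v s" "x \<in> X" "x \<notin> active M n F P v (Suc s)"
proof -
  have "\<exists>s<r. X \<subseteq> active M n F P v s \<and> \<not> X \<subseteq> active M n F P v (Suc s)"
    using ex_least_nat_less[of "\<lambda>t. \<not> X \<subseteq> active M n F P v t" r] assms
    by (auto simp: active_0)
  then show thesis
    using that by blast
qed

lemma outcome_omits_first_exit:
  assumes "X \<subseteq> {..<n}" "outcome M n F P v \<noteq> {}" "\<not> X \<subseteq> outcome M n F P v"
  obtains x where "x \<in> X" "\<And>w. raised_on (X - {x}) v w \<Longrightarrow> x \<notin> outcome M n F P w"
proof -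
  obtain r where r: "outcome M n F P v = active M n F P v r"
    and running: "\<And>s. s < r \<Longrightarrow> active M n F P v s \<notin> F"
    using outcome_nonemptyE[OF assms(2)] by blast
  obtain s x where "s < r" and stay: "X \<subseteq> active M n F P v s"
    and "x \<in> X" and exit: "x \<notin> active M n F P v (Suc s)"
    using first_exitE[OF assms(1)] assms(3) r by metis
  have "x \<notin> outcome M n F P w" if w: "raised_on (X - {x}) v w" for w
  proof -
    have same_hist: "hist M n F P w t = hist M n F P v t" if "t \<le> s" for t
      using stay active_antimono[OF that] by (intro hist_raised_on[OF w]) blast
    have "active M n F P w t \<notin> F" if "t < Suc s" for t
      using running[of t] same_hist[of t] that \<open>s < r\<close> by (simp add: active_def)
    then have "outcome M n F P w \<subseteq> active M n F P w (Suc s)"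
      by (rule outcome_subset_active)
    moreover have "x \<notin> active M n F P w (Suc s)"
      using exit same_hist[of s] raised_on_eq[OF w, of x]
      by (simp add: active_Suc) (simp add: active_def price_def)
    ultimately show ?thesis
      by blast
  qed
  with \<open>x \<in> X\<close> show thesis
    by (rule that)
qed

section \<open>Harmonic elimination\<close>

text \<open>
  Several bidders may exit in the same round. Being locked out whatever the others do from now on is
  what lets the adversary treat such exits one at a time.
\<close>

definition locked_out ::
  "auction \<Rightarrow> nat \<Rightarrow> nat set set \<Rightarrow> nat set \<Rightarrow> (nat \<Rightarrow> real) \<Rightarrow> nat set \<Rightarrow> nat set \<Rightarrow> bool" where
  "locked_out M n F P v X Y \<longleftrightarrow> (\<forall>w. raised_on X v w \<longrightarrow> outcome M n F P w \<inter> Y = {})"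

lemma locked_out_outcome: "locked_out M n F P v X Y \<Longrightarrow> outcome M n F P v \<inter> Y = {}"
  by (simp add: locked_out_def raised_on_refl)

lemma locked_out_raise:
  "locked_out M n F P v X Y \<Longrightarrow> raised_on X v w \<Longrightarrow> locked_out M n F P w X Y"
  unfolding locked_out_def by (blast intro: raised_on_trans)

lemma locked_out_first_exit:
  assumes "locked_out M n F P v X Y"
    and "X \<subseteq> {..<n}" "outcome M n F P v \<noteq> {}" "\<not> X \<subseteq> outcome M n F P v"
  obtains x where "x \<in> X" "locked_out M n F P v (X - {x}) (insert x Y)"
proof -
  obtain x where "x \<in> X" "\<And>w. raised_on (X - {x}) v w \<Longrightarrow> x \<notin> outcome M n F P w"
    using outcome_omits_first_exit[OF assms(2-4)] by blast
  then show thesis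
    using assms(1) raised_on_mono[of "X - {x}" v _ X]
    by (intro that[of x]) (auto simp: locked_out_def)
qed

definition harmonic_profile ::
  "real \<Rightarrow> (nat \<Rightarrow> real) \<Rightarrow> nat set \<Rightarrow> nat set \<Rightarrow> (nat \<Rightarrow> real) \<Rightarrow> bool" where
  "harmonic_profile D u A X v \<longleftrightarrow> X \<subseteq> A \<and> raised_on A u v \<and>
     (\<forall>i\<in>X. v i = D / card X) \<and> setval v (A - X) = D * (harm (card A) - harm (card X))"

lemma setval_harmonic_profile:
  assumes "harmonic_profile D u A X v" "finite X" "X \<noteq> {}"
  shows "setval v X = D"
  using assms by (simp add: harmonic_profile_def setval_def)

lemma harmonic_profile_exit:
  assumes profile: "harmonic_profile D u A X v" and "finite A" "0 \<le> D" "x \<in> X"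
    and card: "card (X - {x}) = k" "0 < k"
  obtains w where "raised_on (X - {x}) v w" "harmonic_profile D u A (X - {x}) w"
proof
  let ?Y = "X - {x}"
  define w where "w = (\<lambda>i. if i \<in> ?Y then D / k else v i)"
  have X: "X \<subseteq> A" "finite X" and cardX: "card X = Suc k"
    using assms by (auto simp: harmonic_profile_def intro: finite_subset)
  have vX: "v i = D / Suc k" if "i \<in> X" for i
    using profile that by (simp add: harmonic_profile_def cardX)
  have "D / Suc k \<le> D / k"
    using \<open>0 \<le> D\<close> \<open>0 < k\<close> by (intro divide_left_mono) auto
  then show raise: "raised_on ?Y v w"
    using vX by (auto simp: raised_on_def w_def)
  have "A - ?Y = insert x (A - X)"
    using X \<open>x \<in> X\<close> by blast
  then have "setval w (A - ?Y) = setval v (insert x (A - X))"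
    using setval_raised_on[OF raise, of "A - ?Y"] by auto
  also have "\<dots> = D / Suc k + D * (harm (card A) - harm (Suc k))"
    using profile \<open>finite A\<close> \<open>x \<in> X\<close> vX
    by (simp add: setval_def harmonic_profile_def cardX)
  also have "\<dots> = D * (harm (card A) - harm k)"
    by (simp add: harm_Suc divide_inverse algebra_simps)
  finally have "setval w (A - ?Y) = D * (harm (card A) - harm k)" .
  moreover have "raised_on A u w"
    using profile raised_on_mono[OF raise, of A] X
    by (auto simp: harmonic_profile_def intro: raised_on_trans)
  ultimately show "harmonic_profile D u A ?Y w"
    using X card by (auto simp: harmonic_profile_def w_def)
qed

lemma harmonic_elimination:
  assumes A: "A \<subseteq> {..<n}" and "0 \<le> D" and start: "\<And>i. i \<in> A \<Longrightarrow> u i = D / card A"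
    and exit: "\<And>X v. X \<noteq> {} \<Longrightarrow> harmonic_profile D u A X v \<Longrightarrow> locked_out M n F P v X (A - X) \<Longrightarrow>
      outcome M n F P v \<noteq> {} \<and> \<not> X \<subseteq> outcome M n F P v"
    and k: "0 < k" "k \<le> card A"
  shows "\<exists>X v. card X = k \<and> harmonic_profile D u A X v \<and> locked_out M n F P v X (A - X)"
  using k(2,1)
proof (induction k rule: inc_induct)
  case base
  have "harmonic_profile D u A A u"
    using start by (simp add: harmonic_profile_def raised_on_refl setval_def)
  then show ?case
    by (intro exI[of _ A] exI[of _ u]) (simp add: locked_out_def)
next
  case (step k)
  then obtain X v where card: "card X = Suc k" and profile: "harmonic_profile D u A X v"
    and locked: "locked_out M n F P v X (A - X)"
    by auto
  have "finite A" "X \<subseteq> A" "X \<noteq> {}"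
    using A card profile by (auto simp: harmonic_profile_def intro: finite_subset)
  obtain x where "x \<in> X" and locked_x: "locked_out M n F P v (X - {x}) (insert x (A - X))"
    using locked_out_first_exit[OF locked] exit[OF \<open>X \<noteq> {}\<close> profile locked] \<open>X \<subseteq> A\<close> A
    by blast
  have card_rest: "card (X - {x}) = k"
    using card \<open>x \<in> X\<close> by simp
  obtain w where raise: "raised_on (X - {x}) v w"
    and profile_rest: "harmonic_profile D u A (X - {x}) w"
    using harmonic_profile_exit[OF profile \<open>finite A\<close> \<open>0 \<le> D\<close> \<open>x \<in> X\<close> card_rest \<open>0 < k\<close>] by blast
  have "insert x (A - X) = A - (X - {x})"
    using \<open>x \<in> X\<close> \<open>X \<subseteq> A\<close> by blast
  then have "locked_out M n F P w (X - {x}) (A - (X - {x}))"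
    using locked_out_raise[OF locked_x raise] by simp
  with card_rest profile_rest show ?case
    by blast
qed

section \<open>A coalition against a rival\<close>

locale rival =
  fixes n :: nat and r :: nat and A :: "nat set" and vmin L :: real
  assumes bidders: "r < n" "A \<subseteq> {..<n}" "r \<notin> A" "A \<noteq> {}"
    and vmin: "0 < vmin" and L: "1 \<le> L"
begin

definition feasible_sets :: "nat set set" where
  "feasible_sets = insert {r} (Pow A)"

definition budget :: real where
  "budget = card A * vmin"

definition initial_value :: "nat \<Rightarrow> real" where
  "initial_value i = (if i = r then L * budget else vmin)"

lemma finite_coalition: "finite A"
  using bidders(2) by (rule finite_subset) simp

lemma card_coalition_pos: "0 < card A"
  using bidders(4) finite_coalition by (simp add: card_gt_0_iff)

lemma finite_feasible_sets: "finite feasible_sets"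
  by (simp add: feasible_sets_def finite_coalition)

lemma coalition_feasible: "A \<in> feasible_sets"
  by (simp add: feasible_sets_def)

lemma feasibility_system_feasible_sets: "feasibility_system n feasible_sets"
  using bidders by (auto simp: feasibility_system_def feasible_sets_def)

lemma outcome_cases: "outcome M n feasible_sets P v = {r} \<or> outcome M n feasible_sets P v \<subseteq> A"
  using outcome_in_feasible[of feasible_sets M n P v] by (auto simp: feasible_sets_def)

lemma budget_pos: "0 < budget"
  using card_coalition_pos vmin by (simp add: budget_def)

lemma budget_le_rival: "budget \<le> L * budget"
  using budget_pos L by simp

lemma vmin_le_budget: "vmin \<le> budget"
  using card_coalition_pos vmin by (simp add: budget_def)

lemma vmin_le_initial_value: "vmin \<le> initial_value i"
  using vmin_le_budget budget_le_rival by (simp add: initial_value_def)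

lemma vmin_le_raised:
  assumes "raised_on A initial_value v"
  shows "vmin \<le> v i"
  using vmin_le_initial_value raised_on_le[OF assms] by (rule order_trans)

lemma valid_instance_raised:
  "raised_on A initial_value v \<Longrightarrow> valid_instance n vmin feasible_sets v"
  by (simp add: valid_instance_def feasibility_system_feasible_sets vmin_le_raised)

lemma raised_nonneg: "raised_on A initial_value v \<Longrightarrow> 0 \<le> v i"
  using vmin vmin_le_raised[of v i] by simp

lemma raised_rival: "raised_on A initial_value v \<Longrightarrow> v r = L * budget"
  using raised_on_eq[of A initial_value v r] bidders(3) by (simp add: initial_value_def)

lemma rival_wins:
  assumes rob: "robustness n vmin M < ereal L"
    and "X \<noteq> {}" and profile: "harmonic_profile budget initial_value A X v"
    and locked: "locked_out M n feasible_sets A v X (A - X)"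
  shows "outcome M n feasible_sets A v = {r}"
proof (rule ccontr)
  assume "outcome M n feasible_sets A v \<noteq> {r}"
  then have served: "outcome M n feasible_sets A v \<subseteq> X"
    using outcome_cases[of M A v] locked_out_outcome[OF locked] by blast
  have raised: "raised_on A initial_value v" and "finite X"
    using profile finite_coalition by (auto simp: harmonic_profile_def intro: finite_subset)
  have "setval v (outcome M n feasible_sets A v) \<le> setval v X"
    using served \<open>finite X\<close> raised_nonneg[OF raised] by (intro setval_mono) auto
  also have "\<dots> = budget"
    using setval_harmonic_profile[OF profile \<open>finite X\<close> \<open>X \<noteq> {}\<close>] .
  finally have "setval v (outcome M n feasible_sets A v) \<le> budget" .
  moreover have "L * budget \<le> opt_val feasible_sets v"
    using setval_le_opt_val[OF finite_feasible_sets, of "{r}" v] raised_rival[OF raised]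
    by (simp add: feasible_sets_def setval_def)
  ultimately have "ereal L \<le> inst_ratio M n feasible_sets A v"
    using L budget_pos raised_nonneg[OF raised] by (intro inst_ratio_ge setval_nonneg) auto
  also have "\<dots> \<le> robustness n vmin M"
    using valid_instance_raised[OF raised] coalition_feasible by (rule inst_ratio_le_robustness)
  finally show False
    using rob by simp
qed

lemma coalition_optimal:
  assumes raised: "raised_on A initial_value v" and x: "x \<in> A" "v x = L * budget"
  shows "is_opt feasible_sets v A"
proof (rule is_optI[OF finite_feasible_sets coalition_feasible])
  fix S
  assume "S \<in> feasible_sets"
  then consider "S = {r}" | "S \<subseteq> A"
    by (auto simp: feasible_sets_def)
  then show "setval v S \<le> setval v A"
  proof cases
    assume "S = {r}"
    then have "setval v S = setval v {x}"
      using x raised_rival[OF raised] by (simp add: setval_def)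
    also have "\<dots> \<le> setval v A"
      using x finite_coalition raised_nonneg[OF raised] by (intro setval_mono) auto
    finally show ?thesis .
  qed (use finite_coalition raised_nonneg[OF raised] in \<open>intro setval_mono\<close>)
qed

lemma lone_survivor_outcome_le:
  assumes raised: "raised_on A initial_value v"
    and locked: "locked_out M n feasible_sets A v {x} (A - {x})" and x: "v x = L * budget"
  shows "setval v (outcome M n feasible_sets A v) \<le> L * budget"
proof -
  have "outcome M n feasible_sets A v \<inter> (A - {x}) = {}"
    using locked by (rule locked_out_outcome)
  then consider "outcome M n feasible_sets A v = {}" | "outcome M n feasible_sets A v = {x}"
    | "outcome M n feasible_sets A v = {r}"
    using outcome_cases[of M A v] by blast
  then show ?thesis
    using budget_pos L x raised_rival[OF raised] by cases (simp_all add: setval_def)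
qed

lemma consistency_ge_lone_survivor:
  assumes profile: "harmonic_profile budget initial_value A {x} v"
    and locked: "locked_out M n feasible_sets A v {x} (A - {x})"
  shows "ereal (1 + (harm (card A) - 1) / L) \<le> consistency n vmin M"
proof -
  define w where "w = v(x := L * budget)"
  have "x \<in> A" "v x = budget" and left: "setval v (A - {x}) = budget * (harm (card A) - 1)"
    using profile by (simp_all add: harmonic_profile_def harm_expand)
  then have raise: "raised_on {x} v w"
    using budget_le_rival by (simp add: raised_on_def w_def)
  then have raised: "raised_on A initial_value w"
    using profile raised_on_mono[OF raise, of A] \<open>x \<in> A\<close>
    by (auto simp: harmonic_profile_def intro: raised_on_trans)
  have served: "setval w (outcome M n feasible_sets A w) \<le> L * budget"
    using raised locked_out_raise[OF locked raise]
    by (rule lone_survivor_outcome_le) (simp add: w_def)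
  have opt: "is_opt feasible_sets w A"
    using raised \<open>x \<in> A\<close> by (rule coalition_optimal) (simp add: w_def)
  have "opt_val feasible_sets w = setval w A"
    using opt by (simp add: is_opt_def)
  also have "\<dots> = L * budget + setval w (A - {x})"
    using \<open>x \<in> A\<close> finite_coalition by (simp add: setval_def sum.remove w_def)
  also have "setval w (A - {x}) = budget * (harm (card A) - 1)"
    using setval_raised_on[OF raise, of "A - {x}"] left by simp
  also have "L * budget + budget * (harm (card A) - 1) =
      (1 + (harm (card A) - 1) / L) * (L * budget)"
    using L by (simp add: field_simps)
  finally have "opt_val feasible_sets w = (1 + (harm (card A) - 1) / L) * (L * budget)" .
  moreover have "1 \<le> (harm (card A) :: real)"
    using harm_mono[of 1 "card A"] card_coalition_pos by (simp add: harm_expand Suc_le_eq)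
  ultimately have "ereal (1 + (harm (card A) - 1) / L) \<le> inst_ratio M n feasible_sets A w"
    using served L budget_pos raised_nonneg[OF raised]
    by (intro inst_ratio_ge[where D = "L * budget"] setval_nonneg add_pos_nonneg) auto
  also have "\<dots> \<le> consistency n vmin M"
    using valid_instance_raised[OF raised] opt by (rule inst_ratio_le_consistency)
  finally show ?thesis .
qed

lemma robustness_consistency_tradeoff:
  "ereal L \<le> robustness n vmin M \<or>
     ereal (1 + (harm (card A) - 1) / L) \<le> consistency n vmin M"
proof (cases "ereal L \<le> robustness n vmin M")
  case False
  then have rob: "robustness n vmin M < ereal L"
    by simp
  have "outcome M n feasible_sets A v \<noteq> {} \<and> \<not> X \<subseteq> outcome M n feasible_sets A v"
    if "X \<noteq> {}" "harmonic_profile budget initial_value A X v"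
      "locked_out M n feasible_sets A v X (A - X)" for X v
    using rival_wins[OF rob that] that bidders by (auto simp: harmonic_profile_def)
  moreover have "initial_value i = budget / card A" if "i \<in> A" for i
    using that bidders(3) card_coalition_pos by (auto simp: initial_value_def budget_def)
  ultimately obtain X v where "card X = 1" "harmonic_profile budget initial_value A X v"
    "locked_out M n feasible_sets A v X (A - X)"
    using harmonic_elimination[of A n budget initial_value M feasible_sets A 1]
      bidders(2) budget_pos card_coalition_pos
    by (auto simp: Suc_le_eq)
  then show ?thesis
    using consistency_ge_lone_survivor by (auto simp: card_1_singleton_iff)
qed simp

end

lemma ln_div_le_robustness:
  assumes "0 < \<epsilon>" "exp (2 * \<epsilon> + 3) \<le> real n" "0 < vmin"
    and cons: "consistency n vmin M \<le> ereal (1 + \<epsilon>)"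
  shows "ereal (ln (real n) / (2 * \<epsilon>)) \<le> robustness n vmin M"
proof -
  have "1 < exp (2 * \<epsilon> + 3)"
    using assms by simp
  then have n: "2 \<le> n"
    using assms by linarith
  then have ln_n: "2 * \<epsilon> + 3 \<le> ln (real n)"
    using assms by (simp add: ln_ge_iff)
  interpret rival n 0 "{1..<n}" vmin "ln (real n) / (2 * \<epsilon>)"
    using n ln_n assms by unfold_locales (auto simp: le_divide_eq)
  have "ln (real n) \<le> harm (n - 1)"
    using ln_le_harm[of "n - 1"] n by (simp add: of_nat_diff)
  then have "ln (real n) / 2 < harm (n - 1) - 1"
    using ln_n assms by linarith
  then have "\<epsilon> < (harm (n - 1) - 1) / (ln (real n) / (2 * \<epsilon>))"
    using ln_n assms by (simp add: less_divide_eq)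
  then have "consistency n vmin M <
      ereal (1 + (harm (card {1..<n}) - 1) / (ln (real n) / (2 * \<epsilon>)))"
    by (intro le_less_trans[OF cons]) simp
  then show ?thesis
    using robustness_consistency_tradeoff[of M] by (meson leD)
qed

theorem theorem2:
  shows "\<exists>c>0. \<forall>\<epsilon>>0. \<exists>n0. \<forall>n\<ge>n0. \<forall>vmin>0. \<forall>M.
           clock_auction n vmin M \<and> consistency n vmin M \<le> ereal (1 + \<epsilon>) \<longrightarrow>
           robustness n vmin M \<ge> ereal (c / \<epsilon> * ln (real n))"
proof (intro exI[of _ "1 / 2"] conjI allI impI)
  fix \<epsilon> :: real
  assume "0 < \<epsilon>"
  show "\<exists>n0. \<forall>n\<ge>n0. \<forall>vmin>0. \<forall>M.
           clock_auction n vmin M \<and> consistency n vmin M \<le> ereal (1 + \<epsilon>) \<longrightarrow>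
           robustness n vmin M \<ge> ereal (1 / 2 / \<epsilon> * ln (real n))"
  proof (intro exI[of _ "nat \<lceil>exp (2 * \<epsilon> + 3)\<rceil>"] allI impI)
    fix n :: nat and vmin :: real and M :: auction
    assume "nat \<lceil>exp (2 * \<epsilon> + 3)\<rceil> \<le> n" "0 < vmin"
      and "clock_auction n vmin M \<and> consistency n vmin M \<le> ereal (1 + \<epsilon>)"
    then have "ereal (ln (real n) / (2 * \<epsilon>)) \<le> robustness n vmin M"
      using \<open>0 < \<epsilon>\<close> by (intro ln_div_le_robustness) (auto simp: nat_le_iff ceiling_le_iff)
    then show "ereal (1 / 2 / \<epsilon> * ln (real n)) \<le> robustness n vmin M"
      by simp
  qed
qed simp

end
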